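(* Let $q$ be a prime power, let $k,n$ be positive integers with $k\mid n$ and $n/k\ge 2$, and let $\gamma\in\mathbb{F}_{q^n}$ be a root of an irreducible polynomial of degree $\frac{n}{k}$ over $\mathbb{F}_{q^k}$. Let $V_{g,\gamma}=\{u+g(u)\gamma : u\in\mathbb{F}_{q^k}\}$ be the $\mathbb{F}_q$-subspace of $\mathbb{F}_{q^n}$ where $g(x)=x^{q^i}+\delta x^{q^j}\in\mathcal{L}_{k,q}$ (with $\delta\in\mathbb{F}_{q^k}$) and $0<i<j<k$. If $F\in\mathcal{L}_{n,q}$ is a subspace polynomial with $\ker(F)=V_{g,\gamma}$, then $F$ is not a trinomial.
   Context: For a positive integer $m$, $\mathcal{L}_{m,q}$ is the set of linearized polynomials ($q$-polynomials) $\sum_{i=0}^{t}a_ix^{q^i}$ with $a_i\in\mathbb{F}_{q^m}$; the $q$-degree of a nonzero one is the largest $i$ with $a_i\neq0$. For $F\in\mathcal{L}_{n,q}$, $\ker(F)$ is the kernel of the $\mathbb{F}_q$-linear map $\mathbb{F}_{q^n}\to\mathbb{F}_{q^n}$ defined by $F$. A nonzero $F\in\mathcal{L}_{n,q}$ of $q$-degree less than $n$ is a subspace polynomial if $\dim_{\mathbb{F}_q}\ker(F)$ equals its $q$-degree. A trinomial is a polynomial with exactly three nonzero coefficients.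
   Formalization: The formal statement assumes in addition that δ ≠ 0 or k ≠ 2i; when δ = 0 and k = 2i the claim is false, since F is then always a trinomial a x + b x^{q^i} + c x^{q^k} with nonzero coefficients. *)

theory Defs
  imports "HOL-Algebra.Algebra" "HOL-Number_Theory.Prime_Powers"
begin

text \<open>
  All finite fields involved are subfields of one ambient finite field \<open>R\<close> with \<open>q ^ n\<close> elements.
  Polynomials are those of \<^theory>\<open>HOL-Algebra.Polynomials\<close>, i.e. coefficient lists with the
  leading coefficient first.
\<close>

text \<open>With \<open>K\<close> the subfield of \<open>q ^ m\<close> elements this is the set of \<open>q\<close>-polynomials
  over \<open>K\<close>, including the zero polynomial.\<close>

definition linearized_polys :: "('a, 'b) ring_scheme \<Rightarrow> 'a set \<Rightarrow> nat \<Rightarrow> 'a list set" where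
  "linearized_polys R K q =
     {F \<in> carrier (K[X]\<^bsub>R\<^esub>). \<forall>m. ring.coeff R F m \<noteq> \<zero>\<^bsub>R\<^esub> \<longrightarrow> (\<exists>i. m = q ^ i)}"

text \<open>Only meaningful for nonzero \<open>F\<close> and \<open>q \<ge> 2\<close>.\<close>

definition q_degree :: "('a, 'b) ring_scheme \<Rightarrow> nat \<Rightarrow> 'a list \<Rightarrow> nat" where
  "q_degree R q F = Max {i. ring.coeff R F (q ^ i) \<noteq> \<zero>\<^bsub>R\<^esub>}"

definition poly_ker :: "('a, 'b) ring_scheme \<Rightarrow> 'a list \<Rightarrow> 'a set" where
  "poly_ker R F = a_kernel R R (ring.eval R F)"

text \<open>Here \<open>Fq\<close> is the subfield of \<open>q\<close> elements of \<open>R\<close>, and \<open>R\<close> has \<open>q ^ n\<close> elements.\<close>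

definition subspace_poly ::
  "('a, 'b) ring_scheme \<Rightarrow> 'a set \<Rightarrow> nat \<Rightarrow> nat \<Rightarrow> 'a list \<Rightarrow> bool" where
  "subspace_poly R Fq q n F \<longleftrightarrow>
     F \<in> linearized_polys R (carrier R) q \<and> F \<noteq> [] \<and> q_degree R q F < n \<and>
     ring.dimension R (q_degree R q F) Fq (poly_ker R F)"

definition trinomial :: "('a, 'b) ring_scheme \<Rightarrow> 'a list \<Rightarrow> bool" where
  "trinomial R F \<longleftrightarrow> card {m. ring.coeff R F m \<noteq> \<zero>\<^bsub>R\<^esub>} = 3"

definition V_space :: "('a, 'b) ring_scheme \<Rightarrow> 'a set \<Rightarrow> 'a list \<Rightarrow> 'a \<Rightarrow> 'a set" where
  "V_space R K g \<gamma> = {u \<oplus>\<^bsub>R\<^esub> ring.eval R g u \<otimes>\<^bsub>R\<^esub> \<gamma> | u. u \<in> K}"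

end

theory Submission
  imports Defs
begin

text \<open>
  Counting \<open>V = {u + g(u) \<gamma>}\<close> shows that \<open>F\<close> has \<open>q\<close>-degree \<open>k\<close>, and having \<open>q ^ k\<close> roots it is
  separable. A trinomial \<open>F\<close> thus has the form \<open>a x ^ q ^ k + b x ^ q ^ s + c x\<close> with
  \<open>0 < s < k\<close>. Expanding \<open>F (u + g(u) \<gamma>)\<close> modulo \<open>u ^ q ^ k - u\<close> gives a \<open>q\<close>-polynomial in \<open>u\<close> that
  vanishes on the field of \<open>q ^ k\<close> elements, so all its coefficients are zero. The terms coming from
  \<open>b x ^ q ^ s\<close> sit at the \<open>q\<close>-exponents \<open>s\<close>, \<open>i + s\<close> and \<open>j + s\<close> modulo \<open>k\<close>, whereas the remaining ones
  sit at \<open>0\<close>, \<open>i\<close> and \<open>j\<close>. This forces \<open>s = i\<close> or \<open>s = j\<close>, and comparing the coefficients at \<open>i\<close> and \<open>j\<close>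
  then yields \<open>\<gamma> ^ q ^ s \<in> K\<close>, hence \<open>\<gamma> \<in> K\<close>, which is impossible.
  (If \<open>\<delta> = 0\<close>, the coefficient at \<open>s\<close> or at \<open>i + s\<close> is already nonzero, unless \<open>k = 2 i\<close>.)
\<close>


section \<open>Root counting for sums of powers\<close>

text \<open>A polynomial of degree below \<open>N\<close> with at least \<open>N\<close> roots is
  zero. The terms form a list in which exponents may repeat, so that it can be applied before
  knowing which exponents coincide; the \<open>foldr\<close> in the conclusion collects the
  coefficient at \<open>l\<close>.\<close>

lemma (in field) power_sum_coeffs_zero:
  assumes ts: "\<forall>(a, m) \<in> set ts. a \<in> carrier R \<and> m < N"
    and S: "S \<subseteq> carrier R" "N \<le> card S" "finite S"
    and zero: "\<And>x. x \<in> S \<Longrightarrow> foldr (\<lambda>(a, m) s. a \<otimes> x [^] m \<oplus> s) ts \<zero> = \<zero>"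
  shows "foldr (\<lambda>(a, m) s. (if m = l then a else \<zero>) \<oplus> s) ts \<zero> = \<zero>"
proof -
  \<comment> \<open>The degree bound is guarded because \<open>degree []\<close> is 0, which is not
    below \<open>N\<close> when \<open>N = 0\<close>.\<close>
  have "\<exists>P. polynomial (carrier R) P \<and> (P \<noteq> [] \<longrightarrow> degree P < N) \<and>
      (\<forall>x \<in> carrier R. eval P x = foldr (\<lambda>(a, m) s. a \<otimes> x [^] m \<oplus> s) ts \<zero>) \<and>
      (\<forall>l. coeff P l = foldr (\<lambda>(a, m) s. (if m = l then a else \<zero>) \<oplus> s) ts \<zero>)"
    using ts
  proof (induction ts)
    case Nil
    show ?case by (rule exI[of _ "[]"]) (simp add: polynomial_def)
  next
    case (Cons t ts)
    obtain a m where t: "t = (a, m)" by force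
    then have am: "a \<in> carrier R" "m < N" using Cons.prems by auto
    from Cons obtain P where P: "polynomial (carrier R) P" "P \<noteq> [] \<longrightarrow> degree P < N"
      "\<And>x. x \<in> carrier R \<Longrightarrow> eval P x = foldr (\<lambda>(a, m) s. a \<otimes> x [^] m \<oplus> s) ts \<zero>"
      "\<And>l. coeff P l = foldr (\<lambda>(a, m) s. (if m = l then a else \<zero>) \<oplus> s) ts \<zero>"
      by auto
    note PC = polynomial_in_carrier[OF carrier_is_subring P(1)]
    \<comment> \<open>\<open>monom a m\<close> has leading coefficient \<open>a\<close>, so it is a
      normalised polynomial only for nonzero \<open>a\<close>.\<close>
    show ?case
    proof (cases "a = \<zero>")
      case True
      show ?thesis
        by (rule exI[of _ P])
          (use P PC in \<open>auto simp: t True eval_in_carrier simp flip: P(3,4)\<close>)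
    next
      case False
      have mono: "polynomial (carrier R) (monom a m)"
        using monom_is_polynomial[OF carrier_is_subring] am False by simp
      have MC: "set (monom a m) \<subseteq> carrier R"
        using am by (rule_tac monom_in_carrier)
      have "degree (poly_add (monom a m) P) \<le> max m (degree P)"
        using poly_add_degree[of "monom a m" P] by (simp add: monom_def)
      then have "degree (poly_add (monom a m) P) < N"
        using am P(2) by (cases "P = []") auto
      moreover have "polynomial (carrier R) (poly_add (monom a m) P)"
        by (rule poly_add_closed[OF carrier_is_subring mono P(1)])
      moreover have "coeff (monom a m) l = (if m = l then a else \<zero>)" for l
        by (simp add: monom_coeff)
      ultimately show ?thesis
        by (intro exI[of _ "poly_add (monom a m) P"])
          (simp add: t eval_poly_add[OF MC PC] P(3) poly_add_coeff[OF MC PC] P(4)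
            eval_monom[OF am(1)] del: poly_add.simps)
    qed
  qed
  then obtain P where P: "polynomial (carrier R) P" "P \<noteq> [] \<longrightarrow> degree P < N"
      "\<And>x. x \<in> carrier R \<Longrightarrow> eval P x = foldr (\<lambda>(a, m) s. a \<otimes> x [^] m \<oplus> s) ts \<zero>"
      "\<And>l. coeff P l = foldr (\<lambda>(a, m) s. (if m = l then a else \<zero>) \<oplus> s) ts \<zero>"
    by auto
  have "P = []"
  proof (rule ccontr)
    assume "P \<noteq> []"
    have PC: "P \<in> carrier (poly_ring R)" using P(1) by (simp add: univ_poly_carrier)
    have "S \<subseteq> set_mset (roots P)"
      using \<open>P \<noteq> []\<close> S zero P(3) roots_mem_iff_is_root[OF PC] by (auto simp: is_root_def)
    then have "card S \<le> card (set_mset (roots P))" by (simp add: card_mono)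
    also have "\<dots> \<le> size (roots P)" by (metis mset_set_set_mset_msubset size_mset_mono size_mset_set)
    also have "\<dots> \<le> degree P" by (rule size_roots_le_degree[OF PC])
    finally show False using P(2) \<open>P \<noteq> []\<close> S(2) by simp
  qed
  then show ?thesis using P(4)[of l] by simp
qed

section \<open>Additivity of the Frobenius map\<close>

lemma (in cring) binomial_theorem:
  assumes [simp]: "x \<in> carrier R" "y \<in> carrier R"
  shows "(x \<oplus> y) [^] n = (\<Oplus>i\<in>{..n}. add_pow R (n choose i) (x [^] i \<otimes> y [^] (n - i)))"
proof (induction n)
  case 0
  show ?case by simp
next
  case (Suc n)
  let ?f = "\<lambda>n i. add_pow R (n choose i) (x [^] i \<otimes> y [^] (n - i))"
  \<comment> \<open>Pascal's rule splits each term into \<open>?g\<close>, which gains a factor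
    \<open>x\<close>, and \<open>?h\<close>, which gains a factor \<open>y\<close>. The value at 0
    is set separately because \<open>i - 1\<close> truncates there.\<close>
  let ?g = "\<lambda>i. if i = 0 then \<zero> else add_pow R (n choose (i - 1)) (x [^] i \<otimes> y [^] (Suc n - i))"
  let ?h = "\<lambda>i. add_pow R (n choose i) (x [^] i \<otimes> y [^] (Suc n - i))"
  have "(\<Oplus>i\<in>{..Suc n}. ?f (Suc n) i) = (\<Oplus>i\<in>{..Suc n}. ?g i \<oplus> ?h i)"
  proof (rule finsum_cong')
    fix i assume "i \<in> {..Suc n}"
    show "?f (Suc n) i = ?g i \<oplus> ?h i"
      by (cases i) (auto simp: add.nat_pow_mult simp del: nat_pow_Suc)
  qed auto
  also have "\<dots> = (\<Oplus>i\<in>{..Suc n}. ?g i) \<oplus> (\<Oplus>i\<in>{..Suc n}. ?h i)"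
    by (rule finsum_addf) auto
  also have "(\<Oplus>i\<in>{..Suc n}. ?g i) = (\<Oplus>i\<in>{..n}. ?f n i) \<otimes> x"
  proof -
    have "(\<Oplus>i\<in>{..Suc n}. ?g i) = (\<Oplus>i\<in>{..n}. ?g (Suc i)) \<oplus> ?g 0"
      by (rule finsum_Suc2) auto
    also have "\<dots> = (\<Oplus>i\<in>{..n}. ?f n i \<otimes> x)"
      by (auto intro!: finsum_cong' simp: add_pow_ldistr add_pow_rdistr m_ac)
    also have "\<dots> = (\<Oplus>i\<in>{..n}. ?f n i) \<otimes> x"
      by (rule finsum_ldistr[symmetric]) auto
    finally show ?thesis .
  qed
  also have "(\<Oplus>i\<in>{..Suc n}. ?h i) = (\<Oplus>i\<in>{..n}. ?f n i) \<otimes> y"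
  proof -
    have "(\<Oplus>i\<in>{..Suc n}. ?h i) = (\<Oplus>i\<in>{..n}. ?h i)"
      by (subst finsum_Suc) (auto simp: binomial_eq_0)
    also have "\<dots> = (\<Oplus>i\<in>{..n}. ?f n i \<otimes> y)"
      by (auto intro!: finsum_cong' simp: add_pow_ldistr add_pow_rdistr m_ac Suc_diff_le)
    also have "\<dots> = (\<Oplus>i\<in>{..n}. ?f n i) \<otimes> y"
      by (rule finsum_ldistr[symmetric]) auto
    finally show ?thesis .
  qed
  finally show ?case
    by (simp add: Suc.IH r_distr)
qed

text \<open>The binomial coefficients strictly between 0 and \<open>p\<close> are divisible by
  \<open>p\<close>, so only the two outer terms survive.\<close>

lemma (in cring) freshmans_dream:
  fixes p :: nat
  assumes p: "Factorial_Ring.prime p" and char: "add_pow R p \<one> = \<zero>"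
    and x[simp]: "x \<in> carrier R" and y[simp]: "y \<in> carrier R"
  shows "(x \<oplus> y) [^] p = x [^] p \<oplus> y [^] p"
proof -
  have zero: "add_pow R m z = \<zero>" if m: "p dvd m" and z: "z \<in> carrier R" for m :: nat and z
  proof -
    obtain d where d: "m = p * d" using m by (elim dvdE)
    have "add_pow R p z = (add_pow R p \<one>) \<otimes> z" using z by (simp add: add_pow_ldistr)
    then have "add_pow R p z = \<zero>" using z by (simp add: char)
    then show ?thesis using z unfolding d by (metis add.nat_pow_pow add.nat_pow_one)
  qed
  have p0: "p > 0" using p prime_gt_0_nat by simp
  have "(x \<oplus> y) [^] p = (\<Oplus>i\<in>{..p}. add_pow R (p choose i) (x [^] i \<otimes> y [^] (p - i)))"
    by (rule binomial_theorem) auto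
  also have "\<dots> = (\<Oplus>i\<in>{0, p}. add_pow R (p choose i) (x [^] i \<otimes> y [^] (p - i)))"
  proof (rule add.finprod_mono_neutral_cong_right)
    fix i assume "i \<in> {..p} - {0, p}"
    then show "add_pow R (p choose i) (x [^] i \<otimes> y [^] (p - i)) = \<zero>"
      using p by (auto intro!: zero dvd_choose_prime)
  qed auto
  also have "\<dots> = x [^] p \<oplus> y [^] p"
    using p0 by (simp add: a_comm)
  finally show ?thesis .
qed

text \<open>By Lagrange in the additive group a power of \<open>p\<close> annihilates
  \<open>\<one>\<close>; without zero divisors \<open>p\<close> itself does. The prime case is then
  iterated \<open>e * m\<close> times.\<close>

lemma (in field) finite_field_frobenius_add:
  assumes q: "primepow q" and card: "card (carrier R) = q ^ n" "finite (carrier R)"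
    and x: "x \<in> carrier R" and y: "y \<in> carrier R"
  shows "(x \<oplus> y) [^] (q ^ m) = x [^] (q ^ m) \<oplus> y [^] (q ^ m)"
proof -
  obtain p e where p: "Factorial_Ring.prime p" "q = p ^ e" using q by (auto simp: primepow_def)
  have "add_pow R (card (carrier R)) \<one> = \<zero>"
    using add.pow_order_eq_1[of \<one>] by (simp add: order_def)
  then have "add_pow R (p ^ (e * n)) \<one> = \<zero>" by (simp add: card p power_mult)
  moreover have "add_pow R p \<one> = \<zero>" if "add_pow R (p ^ l) \<one> = \<zero>" for l
    using that
  proof (induction l)
    case 0
    then show ?case by simp
  next
    case (Suc l)
    have "(add_pow R p \<one>) \<otimes> (add_pow R (p ^ l) \<one>) = \<zero>"
      using Suc.prems by (simp add: add_pow_ldistr add.nat_pow_pow mult.commute)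
    then show ?case using Suc.IH integral by auto
  qed
  ultimately have char: "add_pow R p \<one> = \<zero>" by blast
  have "(x \<oplus> y) [^] (p ^ l) = x [^] (p ^ l) \<oplus> y [^] (p ^ l)" for l
  proof (induction l)
    case (Suc l)
    have "(x \<oplus> y) [^] (p ^ Suc l) = ((x \<oplus> y) [^] (p ^ l)) [^] p"
      using x y by (simp add: nat_pow_pow mult.commute)
    also have "\<dots> = (x [^] (p ^ l)) [^] p \<oplus> (y [^] (p ^ l)) [^] p"
      unfolding Suc by (rule freshmans_dream) (use p char x y in auto)
    finally show ?case using x y by (simp add: nat_pow_pow mult.commute)
  qed (use x y in simp)
  from this[of "e * m"] show ?thesis by (simp add: p power_mult)
qed

section \<open>Finite subfields: powers, dimensions and roots\<close>

text \<open>Lagrange in the multiplicative group of \<open>K\<close>. Taking \<open>K\<close> to be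
  the whole field shows that powers of Frobenius can be undone.\<close>

lemma (in field) subfield_pow_card:
  assumes K: "subfield K R" "finite K" and x: "x \<in> K"
  shows "x [^] card K = x"
proof (cases "x = \<zero>")
  case True
  have "card K \<noteq> 0" using K x by auto
  then show ?thesis using True nat_pow_zero by auto
next
  case False
  have xR: "x \<in> carrier R" using subfieldE(3)[OF K(1)] x by auto
  interpret K: field "R \<lparr>carrier := K\<rparr>" by (rule subfield_iff(2)[OF K(1)])
  interpret M: group "Multiplicative_Group.mult_of (R \<lparr>carrier := K\<rparr>)" by (rule K.field_mult_group)
  have "x [^] (card (K - {\<zero>})) = \<one>"
    using M.pow_order_eq_1[of x] x False
    by (simp add: order_def nat_pow_def)
  moreover have "card K = Suc (card (K - {\<zero>}))"
    using K(2) K.zero_closed card_Suc_Diff1[of K \<zero>] by simp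
  ultimately show ?thesis using xR by simp
qed

lemma (in field) subfield_nat_pow_closed:
  assumes "subfield K R" "x \<in> K"
  shows "x [^] (m::nat) \<in> K"
proof (induction m)
  case 0
  show ?case using subringE(3)[OF subfieldE(1)[OF assms(1)]] by simp
next
  case (Suc m)
  then show ?case using subringE(6)[OF subfieldE(1)[OF assms(1)]] assms(2) by simp
qed

text \<open>Extending \<open>E\<close> by a vector \<open>v\<close> outside it multiplies the
  cardinality by \<open>card K\<close>: if \<open>k \<otimes> v \<oplus> e\<close> had two
  representations with different \<open>k\<close>, dividing by the difference would put
  \<open>v\<close> into \<open>E\<close>.\<close>

lemma (in ring) card_dimension:
  assumes "dimension d K E" "subfield K R" "finite K"
  shows "finite E \<and> card E = card K ^ d"
  using assms
proof (induction)
  case (zero_dim K)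
  show ?case by simp
next
  case (Suc_dim v E d K)
  note K = Suc_dim.prems
  note E = space_subgroup_props[OF K(1) Suc_dim.hyps(3)]
  note EC = E(1)
  have KC: "K \<subseteq> carrier R" using subfieldE(3)[OF K(1)] .
  have le: "line_extension K v E = (\<lambda>(k, e). k \<otimes> v \<oplus> e) ` (K \<times> E)"
    by (force simp: line_extension_mem_iff)
  have "inj_on (\<lambda>(k, e). k \<otimes> v \<oplus> e) (K \<times> E)"
  proof (rule inj_onI, clarify)
    fix k e k' e'
    assume *: "k \<in> K" "e \<in> E" "k' \<in> K" "e' \<in> E" "k \<otimes> v \<oplus> e = k' \<otimes> v \<oplus> e'"
    have c: "k \<in> carrier R" "e \<in> carrier R" "k' \<in> carrier R" "e' \<in> carrier R"
      using * EC KC by auto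
    have "(k \<ominus> k') \<otimes> v = (k \<otimes> v \<oplus> e) \<ominus> e \<ominus> k' \<otimes> v"
      using c Suc_dim.hyps(1) by algebra
    also have "\<dots> = e' \<ominus> e" unfolding *(5) using c Suc_dim.hyps(1) by algebra
    finally have eq: "(k \<ominus> k') \<otimes> v = e' \<ominus> e" .
    have e: "e' \<ominus> e \<in> E"
      using *(2,4) E(3,4) by (simp add: a_minus_def)
    have kk: "k \<ominus> k' \<in> K"
      using *(1,3) subringE(5,7)[OF subfieldE(1)[OF K(1)]] by (simp add: a_minus_def)
    have "k = k'"
    proof (rule ccontr)
      assume "k \<noteq> k'"
      then have "k \<ominus> k' \<in> K - {\<zero>}" using kk c by (simp add: r_right_minus_eq)
      note inv = subfield_m_inv[OF K(1) this]
      have "v = inv (k \<ominus> k') \<otimes> ((k \<ominus> k') \<otimes> v)"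
        using inv KC c Suc_dim.hyps(1) by (subst m_assoc[symmetric]) auto
      also have "\<dots> \<in> E" unfolding eq
        using E(5) inv e by simp
      finally show False using Suc_dim.hyps(2) by simp
    qed
    then show "k = k' \<and> e = e'" using *(5) c Suc_dim.hyps(1) by simp
  qed
  then show ?case
    unfolding le using Suc_dim.IH K by (simp add: card_image card_cartesian_product)
qed

text \<open>The minimal polynomial of \<open>x\<close> over \<open>K\<close> is X - x. It divides
  \<open>p\<close>, hence is associated to it by irreducibility. This serves to exclude
  \<open>\<gamma> \<in> K\<close>.\<close>

lemma (in domain) degree_irreducible_of_root_in_subfield:
  assumes K: "subfield K R" and x: "x \<in> K"
    and p: "p \<in> carrier (K[X])" "pirreducible K p" "eval p x = \<zero>"
  shows "degree p = 1"
proof -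
  have xR: "x \<in> carrier R" using subfieldE(3)[OF K] x by auto
  let ?r = "[\<one>, \<ominus> x]"
  have r: "?r \<in> carrier (K[X])"
    using x subringE[OF subfieldE(1)[OF K]] unfolding univ_poly_carrier[symmetric] polynomial_def
    by auto
  have irr: "pirreducible K ?r" by (rule degree_one_imp_pirreducible[OF K r]) simp
  have ev: "eval ?r x = \<zero>" using xR by (simp add: r_neg)
  have alg: "(algebraic over K) x"
    using r ev by (auto intro: algebraicI)
  have "Irr K x = ?r"
    using minimal_polynomial_is_unique[OF K xR alg] IrrE[OF K xR alg] r irr ev by auto
  then have "?r pdivides p" using Irr_minimal[OF K xR alg p(1,3)] by simp
  then have "?r divides\<^bsub>K[X]\<^esub> p" using pdivides_iff_shell[OF K r p(1)] by simp
  then have "?r \<sim>\<^bsub>K[X]\<^esub> p"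
    using divides_pirreducible_condition[OF p(2) r] irr
    unfolding ring_irreducible_def irreducible_def by auto
  then have "length ?r = length p"
    by (rule associated_polynomials_imp_same_length[OF subfieldE(1)[OF K] r p(1)])
  then show ?thesis by simp
qed


section \<open>Comparison of coefficients on \<open>K\<close>\<close>

text \<open>The disjunction on \<open>\<delta>\<close> rules out the case
  \<open>\<delta> = \<zero>\<close>, \<open>k = 2 * i\<close>: there, with \<open>s = i\<close>, the
  coefficients at 0 and \<open>i\<close> give only two linear conditions on \<open>a\<close>,
  \<open>b\<close>, \<open>c\<close>, and these do not force \<open>b = \<zero>\<close>.\<close>

lemma (in field) trinomial_not_vanishing_on_V_space:
  assumes q: "primepow q" and R: "finite (carrier R)" "card (carrier R) = q ^ n"
    and K: "subfield K R" "card K = q ^ k"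
    and \<gamma>: "\<gamma> \<in> carrier R" "\<gamma> \<notin> K"
    and ij: "0 < i" "i < j" "j < k" and s: "0 < s" "s < k" and kn: "k \<le> n"
    and \<delta>: "\<delta> \<in> K" "\<delta> \<noteq> \<zero> \<or> k \<noteq> 2 * i"
    and abc: "a \<in> carrier R" "b \<in> carrier R" "c \<in> carrier R" "b \<noteq> \<zero>"
    and vanish: "\<And>u w. u \<in> K \<Longrightarrow> w = u \<oplus> (u [^] (q ^ i) \<oplus> \<delta> \<otimes> u [^] (q ^ j)) \<otimes> \<gamma> \<Longrightarrow>
       a \<otimes> w [^] (q ^ k) \<oplus> (b \<otimes> w [^] (q ^ s) \<oplus> c \<otimes> w) = \<zero>"
  shows False
proof -
  have q1: "q > 1" using q primepow_gt_Suc_0 by auto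
  have KR: "K \<subseteq> carrier R" by (rule subfieldE(3)[OF K(1)])
  then have finK: "finite K" using R(1) finite_subset by blast
  note frob = finite_field_frobenius_add[OF q R(2,1)]
  have pow_k: "u [^] (q ^ k) = u" if "u \<in> K" for u
    using subfield_pow_card[OF K(1) finK that] K(2) by simp
  have pow_mod: "u [^] (q ^ (m mod k)) = u [^] (q ^ m)" if u: "u \<in> K" for u m
  proof -
    have mult: "u [^] (q ^ (k * d)) = u" for d
    proof (induction d)
      case 0
      show ?case using u KR by auto
    next
      case (Suc d)
      have "u [^] (q ^ (k * Suc d)) = (u [^] (q ^ (k * d))) [^] (q ^ k)"
        using u KR by (subst nat_pow_pow) (auto simp: power_add mult.commute)
      then show ?case using Suc pow_k[OF u] by simp
    qed
    have "u [^] (q ^ m) = (u [^] (q ^ (k * (m div k)))) [^] (q ^ (m mod k))"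
      using u KR by (subst nat_pow_pow) (auto simp flip: power_add)
    then show ?thesis using mult by simp
  qed
  \<comment> \<open>Applying Frobenius \<open>n - s\<close> further times leads back to
    \<open>\<gamma>\<close>, and \<open>K\<close> is closed under powers.\<close>
  have \<gamma>_pow: "\<gamma> [^] (q ^ s) \<notin> K"
  proof
    assume *: "\<gamma> [^] (q ^ s) \<in> K"
    have "\<gamma> = \<gamma> [^] (q ^ n)"
      using subfield_pow_card[OF carrier_is_subfield R(1) \<gamma>(1)] R(2) by simp
    also have "\<dots> = (\<gamma> [^] (q ^ s)) [^] (q ^ (n - s))"
      using \<gamma>(1) s kn by (subst nat_pow_pow) (auto simp flip: power_add)
    also have "\<dots> \<in> K" using * by (rule subfield_nat_pow_closed[OF K(1)])
    finally show False using \<gamma>(2) by simp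
  qed
  \<comment> \<open>With \<open>g\<close> the binomial, \<open>A\<close> is the factor of
    \<open>g(u)\<close> in the outer two terms of the trinomial. Raising to the power
    \<open>q ^ s\<close> moves the q-exponents \<open>i\<close> and \<open>j\<close> to
    \<open>x\<close> and \<open>y\<close>, since \<open>u [^] (q ^ k) = u\<close> on
    \<open>K\<close>.\<close>
  define \<Gamma> D where "\<Gamma> = \<gamma> [^] (q ^ s)" and "D = \<delta> [^] (q ^ s)"
  define A where "A = a \<otimes> \<gamma> [^] (q ^ k) \<oplus> c \<otimes> \<gamma>"
  define x y where "x = (i + s) mod k" and "y = (j + s) mod k"
  have D: "D \<in> K" unfolding D_def by (rule subfield_nat_pow_closed[OF K(1) \<delta>(1)])
  have cl: "\<Gamma> \<in> carrier R" "D \<in> carrier R" "A \<in> carrier R" "\<delta> \<in> carrier R"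
    using \<gamma> D KR abc \<delta> by (auto simp: \<Gamma>_def A_def)
  have \<Gamma>0: "\<Gamma> \<noteq> \<zero>"
    using \<gamma>_pow subringE(2)[OF subfieldE(1)[OF K(1)]] by (auto simp: \<Gamma>_def)
  \<comment> \<open>The coefficients of the trinomial at \<open>u + g(u) \<gamma>\<close> as a polynomial in \<open>u\<close>, reduced
    modulo \<open>u ^ q ^ k - u\<close>; the exponents in the list may coincide.\<close>
  let ?ts = "[(a \<oplus> c, q ^ 0), (A, q ^ i), (A \<otimes> \<delta>, q ^ j), (b, q ^ s),
    (b \<otimes> \<Gamma>, q ^ x), (b \<otimes> D \<otimes> \<Gamma>, q ^ y)]"
  have "foldr (\<lambda>(a, m) s. (if m = l then a else \<zero>) \<oplus> s) ?ts \<zero> = \<zero>" for l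
  proof (rule power_sum_coeffs_zero[where S = K and N = "q ^ k"])
    have "1 < q ^ k" using q1 s by (intro one_less_power) auto
    moreover have "x < k" "y < k" using s by (auto simp: x_def y_def)
    ultimately show "\<forall>(a, m)\<in>set ?ts. a \<in> carrier R \<and> m < q ^ k"
      using cl abc q1 ij s by (auto simp: one_less_power)
    fix u assume u: "u \<in> K"
    define ui uj us ux uy where "ui = u [^] (q ^ i)" and "uj = u [^] (q ^ j)" and
      "us = u [^] (q ^ s)" and "ux = u [^] (q ^ x)" and "uy = u [^] (q ^ y)"
    have uK: "ui \<in> K" "uj \<in> K" using u K(1) by (auto simp: ui_def uj_def subfield_nat_pow_closed)
    have uR: "u \<in> carrier R" "ui \<in> carrier R" "uj \<in> carrier R"
      "us \<in> carrier R" "ux \<in> carrier R" "uy \<in> carrier R"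
      using u KR by (auto simp: ui_def uj_def us_def ux_def uy_def)
    have ux: "ui [^] (q ^ s) = ux" and uy: "uj [^] (q ^ s) = uy"
      using uR(1) u by (simp_all add: ui_def uj_def ux_def uy_def x_def y_def pow_mod
          nat_pow_pow power_add)
    define w where "w = u \<oplus> (ui \<oplus> \<delta> \<otimes> uj) \<otimes> \<gamma>"
    have ws: "w [^] (q ^ s) = us \<oplus> (ux \<oplus> D \<otimes> uy) \<otimes> \<Gamma>"
      using uR cl \<gamma>(1) by (simp add: w_def frob nat_pow_distrib ux uy us_def D_def \<Gamma>_def)
    \<comment> \<open>The power \<open>q ^ k\<close> fixes everything in \<open>K\<close>, so only
      \<open>\<gamma>\<close> changes.\<close>
    have wk: "w [^] (q ^ k) = u \<oplus> (ui \<oplus> \<delta> \<otimes> uj) \<otimes> \<gamma> [^] (q ^ k)"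
      using uR cl \<gamma>(1) by (simp add: w_def frob nat_pow_distrib pow_k u uK \<delta>(1))
    define v \<Gamma>k where "v = ui \<oplus> \<delta> \<otimes> uj" and "\<Gamma>k = \<gamma> [^] (q ^ k)"
    have vR: "v \<in> carrier R" "\<Gamma>k \<in> carrier R" using uR cl \<gamma>(1) by (auto simp: v_def \<Gamma>k_def)
    have "\<zero> = a \<otimes> w [^] (q ^ k) \<oplus> (b \<otimes> w [^] (q ^ s) \<oplus> c \<otimes> w)"
      by (rule vanish[OF u, symmetric]) (simp add: w_def ui_def uj_def)
    also have "\<dots> = a \<otimes> (u \<oplus> v \<otimes> \<Gamma>k) \<oplus> (b \<otimes> (us \<oplus> (ux \<oplus> D \<otimes> uy) \<otimes> \<Gamma>) \<oplus> c \<otimes> (u \<oplus> v \<otimes> \<gamma>))"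
      unfolding ws wk unfolding w_def v_def \<Gamma>k_def ..
    also have "\<dots> = (a \<oplus> c) \<otimes> u \<oplus> ((a \<otimes> \<Gamma>k \<oplus> c \<otimes> \<gamma>) \<otimes> v \<oplus> (b \<otimes> us \<oplus>
        (b \<otimes> \<Gamma> \<otimes> ux \<oplus> b \<otimes> D \<otimes> \<Gamma> \<otimes> uy)))"
      using uR vR cl abc \<gamma>(1) by algebra
    also have "(a \<otimes> \<Gamma>k \<oplus> c \<otimes> \<gamma>) \<otimes> v = A \<otimes> ui \<oplus> A \<otimes> \<delta> \<otimes> uj"
      using uR cl by (simp add: A_def[symmetric] \<Gamma>k_def v_def r_distr m_assoc)
    finally have "(a \<oplus> c) \<otimes> u \<oplus> (A \<otimes> ui \<oplus> (A \<otimes> \<delta> \<otimes> uj \<oplus> (b \<otimes> us \<oplus>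
        (b \<otimes> \<Gamma> \<otimes> ux \<oplus> b \<otimes> D \<otimes> \<Gamma> \<otimes> uy)))) = \<zero>"
      using uR cl abc by (simp add: a_assoc)
    then show "foldr (\<lambda>(a, m) s. a \<otimes> u [^] m \<oplus> s) ?ts \<zero> = \<zero>"
      using uR cl abc by (simp add: ui_def uj_def us_def ux_def uy_def)
  qed (use KR K(2) finK in auto)
  note sums = this
  have inj: "q ^ m = q ^ m' \<longleftrightarrow> m = m'" for m m'
    using q1 by (simp add: power_inject_exp)
  have coeff:
    "(if 0 = m then a \<oplus> c else \<zero>) \<oplus> ((if i = m then A else \<zero>) \<oplus> ((if j = m then A \<otimes> \<delta> else \<zero>) \<oplus>
     ((if s = m then b else \<zero>) \<oplus> ((if x = m then b \<otimes> \<Gamma> else \<zero>) \<oplus>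
     ((if y = m then b \<otimes> D \<otimes> \<Gamma> else \<zero>) \<oplus> \<zero>))))) = \<zero>" for m
    using sums[of "q ^ m"] by (simp only: foldr.simps prod.case o_apply id_apply inj)
  have bG: "b \<otimes> \<Gamma> \<noteq> \<zero>" using abc cl \<Gamma>0 integral by blast
  have D0: "D \<noteq> \<zero>" if "\<delta> \<noteq> \<zero>"
  proof -
    have "\<delta> [^] m \<noteq> \<zero>" for m :: nat
      by (induction m) (use that cl integral in auto)
    then show ?thesis by (simp add: D_def)
  qed
  have bDG: "b \<otimes> D \<otimes> \<Gamma> \<noteq> \<zero>" if "\<delta> \<noteq> \<zero>"
    using D0[OF that] abc cl \<Gamma>0 integral by (metis m_closed)
  have xv: "x = (if i + s < k then i + s else i + s - k)"
    and yv: "y = (if j + s < k then j + s else j + s - k)"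
    using ij s by (auto simp: x_def y_def mod_if)
  \<comment> \<open>A shift modulo \<open>k\<close> by an amount strictly between 0 and
    \<open>k\<close> has no fixed points and is injective; this limits which terms can
    cancel.\<close>
  have xy: "x \<noteq> i" "x \<noteq> s" "y \<noteq> j" "y \<noteq> s" "x \<noteq> y"
    using ij s unfolding xv yv by auto
  \<comment> \<open>Otherwise \<open>b\<close> stands alone at exponent \<open>s\<close>.\<close>
  have sij: "s = i \<or> s = j"
  proof (rule ccontr)
    assume "\<not> ?thesis"
    then show False using coeff[of s] s xy abc(2,4) by auto
  qed
  show False
  proof (cases "\<delta> = \<zero>")
    case True
    then have D00: "D = \<zero>" using q1 by (auto simp: D_def nat_pow_zero)
    \<comment> \<open>With the terms at \<open>j\<close> and \<open>y\<close> gone,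
      \<open>s = j\<close> would leave \<open>b\<close> alone at \<open>j\<close>. For
      \<open>s = i\<close>, \<open>x = 0\<close> would mean \<open>k = 2 * i\<close>, so
      \<open>b \<otimes> \<Gamma>\<close> stands alone at \<open>x\<close>.\<close>
    have "s = i" using sij coeff[of j] xy ij s abc cl True D00 yv xv by (auto split: if_splits)
    moreover have "x \<noteq> 0" using xv \<open>s = i\<close> \<delta>(2) True ij by (auto split: if_splits)
    ultimately show False
      using coeff[of x] xy abc cl True D00 bG by (auto split: if_splits)
  next
    case False
    show False
      using sij
    proof
      assume si: "s = i"
      \<comment> \<open>The term at \<open>y\<close> can only be cancelled at exponent 0; this
        leaves \<open>j\<close> as the only place for the term at \<open>x\<close>.\<close>
      have "y = 0" using coeff[of y] xy abc cl bDG[OF False] si by (auto split: if_splits)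
      moreover have "x = j"
        using coeff[of x] xy abc cl bG si \<open>y = 0\<close> by (auto split: if_splits)
      ultimately have e: "A \<oplus> b = \<zero>" "A \<otimes> \<delta> \<oplus> b \<otimes> \<Gamma> = \<zero>"
        using coeff[of i] coeff[of j] ij si abc cl by auto
      \<comment> \<open>Eliminating \<open>A\<close> from the two relations in \<open>e\<close>
        gives \<open>\<Gamma> = \<delta>\<close>, which lies in \<open>K\<close>.\<close>
      have "b \<otimes> (\<Gamma> \<ominus> \<delta>) = (A \<otimes> \<delta> \<oplus> b \<otimes> \<Gamma>) \<ominus> (A \<oplus> b) \<otimes> \<delta>"
        using abc cl by algebra
      then have "b \<otimes> (\<Gamma> \<ominus> \<delta>) = \<zero>" using cl by (simp add: e a_minus_def)
      then have "\<Gamma> = \<delta>" using abc cl integral by (metis minus_closed r_right_minus_eq)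
      then show False using \<gamma>_pow \<delta>(1) by (simp add: \<Gamma>_def)
    next
      assume sj: "s = j"
      have "x \<noteq> j" "x \<noteq> i" using xy sj by auto
      then have "x = 0" using coeff[of x] xy abc cl bG sj by (auto split: if_splits)
      moreover have "y = i"
        using coeff[of y] xy abc cl bDG[OF False] sj \<open>x = 0\<close> by (auto split: if_splits)
      ultimately have e: "A \<oplus> b \<otimes> D \<otimes> \<Gamma> = \<zero>" "A \<otimes> \<delta> \<oplus> b = \<zero>"
        using coeff[of i] coeff[of j] ij sj abc cl by auto
      \<comment> \<open>Eliminating \<open>A\<close> again, now \<open>\<Gamma>\<close> is the
        inverse of \<open>\<delta> \<otimes> D\<close>, an element of \<open>K\<close>.\<close>
      have "b \<otimes> (\<delta> \<otimes> D \<otimes> \<Gamma> \<ominus> \<one>) = (A \<oplus> b \<otimes> D \<otimes> \<Gamma>) \<otimes> \<delta> \<ominus> (A \<otimes> \<delta> \<oplus> b)"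
        using abc cl by algebra
      then have "b \<otimes> (\<delta> \<otimes> D \<otimes> \<Gamma> \<ominus> \<one>) = \<zero>" using cl by (simp add: e a_minus_def)
      then have "\<delta> \<otimes> D \<otimes> \<Gamma> = \<one>"
        using abc cl integral by (metis m_closed minus_closed one_closed r_right_minus_eq)
      moreover have "\<delta> \<otimes> D \<in> K - {\<zero>}"
        using \<delta>(1) D False D0 cl integral subringE(6)[OF subfieldE(1)[OF K(1)]] by blast
      ultimately have "\<Gamma> \<in> K"
        using subfield_m_inv_simprule[OF K(1) _ cl(1)] subringE(3)[OF subfieldE(1)[OF K(1)]]
        by metis
      then show False using \<gamma>_pow by (simp add: \<Gamma>_def)
    qed
  qed
qed


section \<open>Shape and separability of linearized trinomials\<close>

lemma card_3_linorder:
  fixes I :: "'a::linorder set"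
  assumes "card I = 3"
  obtains r s t where "r < s" "s < t" "I = {r, s, t}"
proof -
  obtain x y z where *: "I = {x, y, z}" "x \<noteq> y" "y \<noteq> z" "x \<noteq> z"
    using assms by (auto simp: card_3_iff)
  show ?thesis
    using * that[of x y z] that[of x z y] that[of y x z] that[of y z x] that[of z x y] that[of z y x]
    by (metis insert_commute neq_iff)
qed

lemma (in field) linearized_trinomial_cases:
  assumes F: "F \<in> linearized_polys R (carrier R) q" and tri: "trinomial R F" and q: "q > 1"
  obtains r s t a b c where "r < s" "s < t" "q_degree R q F = t"
    "a \<in> carrier R" "b \<in> carrier R" "c \<in> carrier R" "a \<noteq> \<zero>" "b \<noteq> \<zero>" "c \<noteq> \<zero>"
    "\<And>x. x \<in> carrier R \<Longrightarrow>
      eval F x = a \<otimes> x [^] (q ^ t) \<oplus> (b \<otimes> x [^] (q ^ s) \<oplus> c \<otimes> x [^] (q ^ r))"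
proof -
  have FP: "polynomial (carrier R) F"
    using F by (simp add: linearized_polys_def univ_poly_carrier)
  define I where "I = {e. coeff F (q ^ e) \<noteq> \<zero>}"
  have supp: "{m. coeff F m \<noteq> \<zero>} = (\<lambda>e. q ^ e) ` I"
    using F by (auto simp: linearized_polys_def I_def)
  have "inj_on (\<lambda>e. q ^ e) I" using q by (auto intro: inj_onI)
  then have "card I = 3"
    using tri unfolding trinomial_def supp by (simp add: card_image)
  then obtain r s t where rst: "r < s" "s < t" and I: "I = {r, s, t}" by (rule card_3_linorder)
  define a b c where "a = coeff F (q ^ t)" and "b = coeff F (q ^ s)" and "c = coeff F (q ^ r)"
  have nz: "a \<noteq> \<zero>" "b \<noteq> \<zero>" "c \<noteq> \<zero>" using I unfolding I_def a_def b_def c_def by auto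
  have cl: "a \<in> carrier R" "b \<in> carrier R" "c \<in> carrier R"
    using poly_coeff_in_carrier[OF carrier_is_subring FP] by (auto simp: a_def b_def c_def)
  let ?A = "monom a (q ^ t)" and ?B = "monom b (q ^ s)" and ?C = "monom c (q ^ r)"
  have mono: "polynomial (carrier R) ?A" "polynomial (carrier R) ?B" "polynomial (carrier R) ?C"
    using monom_is_polynomial[OF carrier_is_subring] cl nz by auto
  note add_closed = poly_add_closed[OF carrier_is_subring] and
    in_carr = polynomial_in_carrier[OF carrier_is_subring]
  let ?G = "poly_add ?A (poly_add ?B ?C)"
  have BC: "polynomial (carrier R) (poly_add ?B ?C)" by (rule add_closed[OF mono(2,3)])
  have G: "polynomial (carrier R) ?G" by (rule add_closed[OF mono(1) BC])
  \<comment> \<open>Normalised polynomials are determined by their coefficients, so \<open>F\<close>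
    can be rebuilt from three monomials and evaluated termwise.\<close>
  have "coeff F m = coeff ?G m" for m
  proof -
    have inj: "q ^ e = q ^ e' \<longleftrightarrow> e = e'" for e e' using q by (simp add: power_inject_exp)
    have "coeff ?G m = (if m = q ^ t then a else \<zero>) \<oplus>
        ((if m = q ^ s then b else \<zero>) \<oplus> (if m = q ^ r then c else \<zero>))"
      by (simp add: poly_add_coeff[OF in_carr[OF mono(1)] in_carr[OF BC]]
          poly_add_coeff[OF in_carr[OF mono(2)] in_carr[OF mono(3)]] monom_coeff del: poly_add.simps)
    moreover have "coeff F m = \<zero>" if "m \<noteq> q ^ t" "m \<noteq> q ^ s" "m \<noteq> q ^ r"
      using supp I that by auto
    moreover have "q ^ t \<noteq> q ^ s" "q ^ t \<noteq> q ^ r" "q ^ s \<noteq> q ^ r" using rst inj by auto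
    ultimately show ?thesis using cl by (cases "m \<in> {q ^ t, q ^ s, q ^ r}") (auto simp: a_def b_def c_def)
  qed
  then have FG: "F = ?G" using coeff_iff_polynomial_cond[OF FP G] by blast
  have ev: "eval F x = a \<otimes> x [^] (q ^ t) \<oplus> (b \<otimes> x [^] (q ^ s) \<oplus> c \<otimes> x [^] (q ^ r))"
    if "x \<in> carrier R" for x
    unfolding FG using that cl
    by (simp add: eval_poly_add[OF in_carr[OF mono(1)] in_carr[OF BC]]
        eval_poly_add[OF in_carr[OF mono(2)] in_carr[OF mono(3)]] eval_monom del: poly_add.simps)
  have "q_degree R q F = t"
    using rst unfolding q_degree_def I_def[symmetric] I by (auto simp: max_def)
  then show ?thesis using that rst cl nz ev by blast
qed

text \<open>If \<open>r > 0\<close>, then the trinomial is \<open>G (x ^ q ^ r)\<close> for some \<open>G\<close> of degree \<open>q ^ (t - r) < q ^ t\<close>,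
  and since \<open>x \<mapsto> x ^ q ^ r\<close> is injective, \<open>G\<close> has too many roots.\<close>

lemma (in field) separable_of_many_roots:
  assumes q: "q > 1" and R: "finite (carrier R)" "card (carrier R) = q ^ n"
    and rst: "r < s" "s < t" "t \<le> n"
    and abc: "a \<in> carrier R" "b \<in> carrier R" "c \<in> carrier R" "a \<noteq> \<zero>"
    and V: "V \<subseteq> carrier R" "card V = q ^ t"
    and vanish: "\<And>x. x \<in> V \<Longrightarrow>
      a \<otimes> x [^] (q ^ t) \<oplus> (b \<otimes> x [^] (q ^ s) \<oplus> c \<otimes> x [^] (q ^ r)) = \<zero>"
  shows "r = 0"
proof (rule ccontr)
  assume r: "r \<noteq> 0"
  have pow: "(x [^] (q ^ r)) [^] (q ^ l) = x [^] (q ^ (l + r))" if "x \<in> carrier R" for x l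
    using that by (simp add: nat_pow_pow power_add mult.commute)
  \<comment> \<open>The inverse is the power \<open>q ^ (n - r)\<close>, because
    \<open>x [^] (q ^ n) = x\<close>.\<close>
  have "inj_on (\<lambda>x. x [^] (q ^ r)) V"
  proof (rule inj_on_inverseI)
    fix x assume "x \<in> V"
    then have x: "x \<in> carrier R" using V by auto
    show "(x [^] (q ^ r)) [^] (q ^ (n - r)) = x"
      using pow[OF x, of "n - r"] subfield_pow_card[OF carrier_is_subfield R(1) x] R(2) rst by simp
  qed
  then have card: "card ((\<lambda>x. x [^] (q ^ r)) ` V) = q ^ t" using V(2) by (simp add: card_image)
  let ?ts = "[(a, q ^ (t - r)), (b, q ^ (s - r)), (c, q ^ 0)]"
  have "foldr (\<lambda>(a, m) s. (if m = q ^ (t - r) then a else \<zero>) \<oplus> s) ?ts \<zero> = \<zero>"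
  proof (rule power_sum_coeffs_zero[where S = "(\<lambda>x. x [^] (q ^ r)) ` V" and N = "q ^ t"])
    have "q ^ (t - r) < q ^ t" "q ^ (s - r) < q ^ t" "q ^ 0 < q ^ t"
      using rst r q by (intro power_strict_increasing; simp)+
    then show "\<forall>(a, m)\<in>set ?ts. a \<in> carrier R \<and> m < q ^ t" using abc by auto
    show "finite ((\<lambda>x. x [^] (q ^ r)) ` V)" using V(1) R(1) finite_subset by blast
    fix y assume "y \<in> (\<lambda>x. x [^] (q ^ r)) ` V"
    then obtain x where x: "x \<in> V" "x \<in> carrier R" "y = x [^] (q ^ r)" using V by auto
    have "y [^] (q ^ (t - r)) = x [^] (q ^ t)" "y [^] (q ^ (s - r)) = x [^] (q ^ s)"
      "y [^] (q ^ 0) = x [^] (q ^ r)"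
      using rst x(2) by (auto simp: x(3) pow)
    then show "foldr (\<lambda>(a, m) s. a \<otimes> y [^] m \<oplus> s) ?ts \<zero> = \<zero>"
      using vanish[OF x(1)] abc x(2) by simp
  qed (use V card in auto)
  \<comment> \<open>The exponent \<open>q ^ (t - r)\<close> occurs only once, so the collected
    coefficient there is \<open>a\<close>, which is nonzero.\<close>
  moreover have "q ^ (s - r) \<noteq> q ^ (t - r)" "q ^ 0 \<noteq> q ^ (t - r)"
    using q rst by (auto simp: power_inject_exp simp del: power_0 dest: power_inject_exp[THEN iffD1])
  ultimately show False using abc by simp
qed

section \<open>The kernel of \<open>F\<close> and the conclusion\<close>

theorem proposition6p9:
  fixes R :: "('a, 'b) ring_scheme" (structure)
    and Fq K :: "'a set"
    and q k n i j :: nat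
    and \<gamma> \<delta> :: 'a
    and p g F :: "'a list"
  assumes "primepow q"
    and "k > 0" and "n > 0" and "k dvd n" and "n div k \<ge> 2"
    and "field R" and "finite (carrier R)" and "card (carrier R) = q ^ n"
    and "subfield Fq R" and "card Fq = q"
    and "subfield K R" and "card K = q ^ k"
    and "\<gamma> \<in> carrier R"
    and "p \<in> carrier (K[X])" and "pirreducible K p" and "degree p = n div k"
    and "ring.is_root R p \<gamma>"
    and "0 < i" and "i < j" and "j < k"
    and "\<delta> \<in> K"
    and "\<delta> \<noteq> \<zero> \<or> k \<noteq> 2 * i"
    and "g = (X [^]\<^bsub>K[X]\<^esub> (q ^ i)) \<oplus>\<^bsub>K[X]\<^esub>
             (ring.poly_of_const R \<delta> \<otimes>\<^bsub>K[X]\<^esub> (X [^]\<^bsub>K[X]\<^esub> (q ^ j)))"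
    and "g \<in> linearized_polys R K q"
    and "subspace_poly R Fq q n F"
    and "poly_ker R F = V_space R K g \<gamma>"
  shows "\<not> trinomial R F"
proof
  assume tri: "trinomial R F"
  interpret field R by fact
  have q: "q > 1" using assms(1) primepow_gt_Suc_0 by auto
  note K = \<open>subfield K R\<close>
  note KR = subfieldE(3)[OF K]
  \<comment> \<open>If \<open>\<gamma>\<close> were in \<open>K\<close>, then \<open>p\<close> would
    have degree 1, but \<open>n div k\<close> is at least 2.\<close>
  have \<gamma>: "\<gamma> \<in> carrier R" "\<gamma> \<notin> K"
    using degree_irreducible_of_root_in_subfield[OF K _ assms(14,15)] assms(5,13,16,17)
    by (auto simp: is_root_def)
  have g: "eval g u = u [^] (q ^ i) \<oplus> \<delta> \<otimes> u [^] (q ^ j)" if "u \<in> K" for u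
  proof -
    have u: "u \<in> carrier R" and \<delta>: "\<delta> \<in> carrier R" using that KR assms(21) by auto
    have X: "X [^]\<^bsub>K[X]\<^esub> m = monom \<one> m" for m :: nat
      using unitary_monom_eq_var_pow[OF subfieldE(1)[OF K]] by simp
    have c: "set (poly_of_const \<delta>) \<subseteq> carrier R" "eval (poly_of_const \<delta>) u = \<delta>"
      using \<delta> u by (auto simp: poly_of_const_def)
    have m: "set (monom \<one> m) \<subseteq> carrier R" for m by (rule monom_in_carrier) simp
    show ?thesis
      unfolding assms(23) univ_poly_add univ_poly_mult X
      using u by (simp add: eval_poly_add[OF m poly_mult_in_carrier[OF c(1) m] u]
          eval_poly_mult[OF c(1) m u] c(2) eval_monom del: poly_add.simps poly_mult.simps)
  qed
  let ?w = "\<lambda>u. u \<oplus> (u [^] (q ^ i) \<oplus> \<delta> \<otimes> u [^] (q ^ j)) \<otimes> \<gamma>"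
  have V: "poly_ker R F = ?w ` K"
    unfolding assms(26) V_space_def Setcompr_eq_image by (simp add: g cong: image_cong_simp)
  \<comment> \<open>Two parameters with the same image but different values of \<open>g\<close>
    would express \<open>\<gamma>\<close> as a quotient of elements of \<open>K\<close>.\<close>
  have "inj_on ?w K"
  proof (rule inj_onI)
    fix u u' assume u: "u \<in> K" "u' \<in> K" and eq: "?w u = ?w u'"
    define v v' where "v = u [^] (q ^ i) \<oplus> \<delta> \<otimes> u [^] (q ^ j)"
      and "v' = u' [^] (q ^ i) \<oplus> \<delta> \<otimes> u' [^] (q ^ j)"
    note sub = subringE[OF subfieldE(1)[OF K]]
    have v: "v \<in> K" "v' \<in> K"
      using u assms(21) by (auto simp: v_def v'_def sub(6,7) subfield_nat_pow_closed[OF K])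
    have cl: "u \<in> carrier R" "u' \<in> carrier R" "v \<in> carrier R" "v' \<in> carrier R"
      using u v KR by auto
    have eq: "u \<oplus> v \<otimes> \<gamma> = u' \<oplus> v' \<otimes> \<gamma>" using eq by (simp add: v_def v'_def)
    have "(v \<ominus> v') \<otimes> \<gamma> = (u \<oplus> v \<otimes> \<gamma>) \<ominus> u \<ominus> v' \<otimes> \<gamma>" using cl \<gamma>(1) by algebra
    also have "\<dots> = u' \<ominus> u" unfolding eq using cl \<gamma>(1) by algebra
    also have "\<dots> \<in> K" using u sub(5,7) by (simp add: a_minus_def)
    finally have "(v \<ominus> v') \<otimes> \<gamma> \<in> K" .
    moreover have "v \<ominus> v' \<in> K" using v sub(5,7) by (simp add: a_minus_def)
    ultimately have "v \<ominus> v' = \<zero>" using \<gamma> subfield_m_inv_simprule[OF K] by blast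
    then have "v = v'" using cl by simp
    then show "u = u'" using eq cl \<gamma>(1) by simp
  qed
  then have cardV: "card (poly_ker R F) = q ^ k" using assms(12) by (simp add: V card_image)
  have F: "F \<in> linearized_polys R (carrier R) q" "q_degree R q F < n"
    "dimension (q_degree R q F) Fq (poly_ker R F)"
    using assms(25) by (auto simp: subspace_poly_def)
  obtain r s t a b c where rst: "r < s" "s < t" "q_degree R q F = t"
    and abc: "a \<in> carrier R" "b \<in> carrier R" "c \<in> carrier R" "a \<noteq> \<zero>" "b \<noteq> \<zero>"
    and ev: "\<And>x. x \<in> carrier R \<Longrightarrow>
      eval F x = a \<otimes> x [^] (q ^ t) \<oplus> (b \<otimes> x [^] (q ^ s) \<oplus> c \<otimes> x [^] (q ^ r))"
    using linearized_trinomial_cases[OF F(1) tri q] by metis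
  have "finite Fq" using subfieldE(3)[OF assms(9)] assms(7) finite_subset by blast
  \<comment> \<open>The kernel is counted a second time, now through its dimension; comparing with
    \<open>cardV\<close> identifies \<open>t\<close> with \<open>k\<close>.\<close>
  then have "card (poly_ker R F) = q ^ t"
    using card_dimension[OF F(3) assms(9)] assms(10) rst by simp
  then have t: "t = k" using cardV q by (simp add: power_inject_exp)
  have ker: "poly_ker R F = {x \<in> carrier R. eval F x = \<zero>}"
    by (simp add: poly_ker_def a_kernel_def')
  have r: "r = 0"
    by (rule separable_of_many_roots[OF q assms(7,8) rst(1,2) _ abc(1-4), of "poly_ker R F"])
      (use cardV t rst F(2) ev in \<open>auto simp: ker\<close>)
  show False
  proof (rule trinomial_not_vanishing_on_V_space[OF assms(1,7,8) K assms(12) \<gamma> assms(18-20) _ _ _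
        assms(21,22) abc(1-3,5)])
    show "0 < s" "s < k" "k \<le> n" using rst t F(2) by auto
    fix u w assume "u \<in> K" "w = ?w u"
    then have "w \<in> poly_ker R F" using V by blast
    then show "a \<otimes> w [^] (q ^ k) \<oplus> (b \<otimes> w [^] (q ^ s) \<oplus> c \<otimes> w) = \<zero>"
      using ev[of w] r t by (simp add: ker)
  qed
qed

end
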